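(* Let $\Omega\in\mathbb{R}$ and let $\phi\in C^3(\mathbb{R}^2)$ satisfy $\nabla^\perp\phi\cdot\nabla\Delta\phi=0$ in $\mathbb{R}^2$ and $\phi(x)=-\frac{\Omega}{2}|x|^2$ for all $x$ outside some ball. Consider the (nonempty, closed) set $$\mathcal I:=\{r\in[0,\infty): \phi(x)=\phi(y)\text{ for all }x,y\in\mathbb{R}^2\text{ with }|x|=|y|=r\}.$$ If $r\in\partial\mathcal I\setminus\{0\}$ is not an isolated point of $\mathcal I$, then $\nabla\phi=0$ on the circle $\partial B_r(0)=\{x:|x|=r\}$.
   Context: $\nabla^\perp:=(-\partial_{x_2},\partial_{x_1})$. The boundary $\partial\mathcal I$ is taken in $[0,\infty)$. *)

theory Defs
  imports "HOL-Analysis.Analysis"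
begin

definition partial :: "'n::finite \<Rightarrow> (real^'n \<Rightarrow> real) \<Rightarrow> real^'n \<Rightarrow> real" where
  "partial i f x = deriv (\<lambda>t. f (x + t *\<^sub>R axis i 1)) 0"

fun Ck :: "nat \<Rightarrow> (real^'n::finite \<Rightarrow> real) \<Rightarrow> bool" where
  "Ck 0 f = continuous_on UNIV f"
| "Ck (Suc k) f = (continuous_on UNIV f \<and>
     (\<forall>i x. (\<lambda>t. f (x + t *\<^sub>R axis i 1)) differentiable (at 0)) \<and>
     (\<forall>i. Ck k (partial i f)))"

definition laplacian :: "(real^2 \<Rightarrow> real) \<Rightarrow> real^2 \<Rightarrow> real" where
  "laplacian f x = partial 1 (partial 1 f) x + partial 2 (partial 2 f) x"

text \<open>nabla-perp f dot nabla g, with nabla-perp = (-d/dx2, d/dx1).\<close>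

definition perp_grad_dot :: "(real^2 \<Rightarrow> real) \<Rightarrow> (real^2 \<Rightarrow> real) \<Rightarrow> real^2 \<Rightarrow> real" where
  "perp_grad_dot f g x = - partial 2 f x * partial 1 g x + partial 1 f x * partial 2 g x"

definition radial_set :: "(real^2 \<Rightarrow> real) \<Rightarrow> real set" where
  "radial_set \<phi> = {r. 0 \<le> r \<and> (\<forall>x y. norm x = r \<longrightarrow> norm y = r \<longrightarrow> \<phi> x = \<phi> y)}"

end

theory Submission
  imports Defs
begin

text \<open>Let \<^term>\<open>u\<close> be the angular derivative of \<^term>\<open>\<phi>\<close>; it vanishes exactly on the circles on
  which \<^term>\<open>\<phi>\<close> is constant. At a non-isolated radius \<^term>\<open>r\<close> both \<^term>\<open>u\<close> and its
  radial derivative vanish on the circle, so the radial derivative of \<^term>\<open>\<phi>\<close> is constant along it.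
  If that constant is nonzero, the Euler equation expresses the angular derivative of the Laplacian as a
  bounded multiple of \<^term>\<open>u\<close> near the circle. The Laplacian commutes with rotations, so
  \<^term>\<open>\<bar>laplacian u z\<bar> \<le> M * \<bar>u z\<bar>\<close> there, with zero Cauchy data on the circle. A Carleman
  estimate forces \<^term>\<open>u\<close> to vanish in a neighbourhood, so \<^term>\<open>r\<close> is interior, not a boundary
  point.\<close>

section \<open>Calculus of C^1 functions of two real variables\<close>

text \<open>The partial derivatives are carried as explicit functions, so higher regularity is
  expressed by applying the predicate again to \<open>gx\<close> and \<open>gy\<close>. Derivatives
  along coordinate lines suffice because continuity of the partials yields total
  differentiability.\<close>

definition has_C1_partials ::
    "(real \<Rightarrow> real \<Rightarrow> real) \<Rightarrow> (real \<Rightarrow> real \<Rightarrow> real) \<Rightarrow> (real \<Rightarrow> real \<Rightarrow> real) \<Rightarrow> bool" where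
  "has_C1_partials g gx gy \<longleftrightarrow>
     (\<forall>x y. ((\<lambda>x. g x y) has_real_derivative gx x y) (at x)) \<and>
     (\<forall>x y. (g x has_real_derivative gy x y) (at y)) \<and>
     continuous_on UNIV (\<lambda>z. gx (fst z) (snd z)) \<and>
     continuous_on UNIV (\<lambda>z. gy (fst z) (snd z))"

lemma has_C1_partialsD:
  assumes "has_C1_partials g gx gy"
  shows "((\<lambda>x. g x y) has_real_derivative gx x y) (at x within S)"
    and "(g x has_real_derivative gy x y) (at y within S)"
    and "continuous_on UNIV (\<lambda>z. gx (fst z) (snd z))"
    and "continuous_on UNIV (\<lambda>z. gy (fst z) (snd z))"
  using assms unfolding has_C1_partials_def by (auto intro: has_field_derivative_at_within)

lemma has_C1_partials_has_derivative:
  assumes "has_C1_partials g gx gy"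
  shows "((\<lambda>z. g (fst z) (snd z)) has_derivative
           (\<lambda>h. gx (fst z) (snd z) * fst h + gy (fst z) (snd z) * snd h)) (at z)"
proof -
  obtain x y where z: "z = (x, y)" by (cases z)
  \<comment> \<open>\<open>has_derivative_partialsI\<close> asks for continuity of an
    operator-valued partial derivative, hence the wrapper \<open>blinfun_mult_right\<close>.\<close>
  have cont: "continuous (at (x, y) within UNIV \<times> UNIV) (\<lambda>(x, y). blinfun_mult_right (gy x y))"
  proof -
    have "continuous_on UNIV (\<lambda>z. blinfun_mult_right (gy (fst z) (snd z)))"
      by (intro continuous_intros has_C1_partialsD(4)[OF assms]
          bounded_linear.continuous_on[OF bounded_linear_blinfun_mult_right])
    then have "isCont (\<lambda>z. blinfun_mult_right (gy (fst z) (snd z))) (x, y)"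
      by (simp add: continuous_on_eq_continuous_at)
    then show ?thesis
      by (simp add: case_prod_beta')
  qed
  have "((\<lambda>(x, y). g x y) has_derivative
          (\<lambda>(tx, ty). gx x y * tx + blinfun_apply (blinfun_mult_right (gy x y)) ty))
        (at (x, y) within UNIV \<times> UNIV)"
    by (rule has_derivative_partialsI[OF _ _ cont])
       (use assms in \<open>auto simp: has_C1_partials_def has_field_derivative_def\<close>)
  then show ?thesis
    by (simp add: z case_prod_beta')
qed

lemma has_C1_partials_continuous:
  assumes "has_C1_partials g gx gy"
  shows "continuous_on UNIV (\<lambda>z. g (fst z) (snd z))"
  using has_C1_partials_has_derivative[OF assms]
  by (meson continuous_at_imp_continuous_on has_derivative_continuous)

lemma has_C1_partials_chain:
  assumes g: "has_C1_partials g gx gy"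
    and X: "(X has_real_derivative X') (at t within S)"
    and Y: "(Y has_real_derivative Y') (at t within S)"
  shows "((\<lambda>t. g (X t) (Y t)) has_real_derivative
           gx (X t) (Y t) * X' + gy (X t) (Y t) * Y') (at t within S)"
proof -
  have "((\<lambda>t. (X t, Y t)) has_derivative (\<lambda>h. (X' * h, Y' * h))) (at t within S)"
    using X Y unfolding has_field_derivative_def by (rule has_derivative_Pair)
  from has_derivative_compose[OF this has_C1_partials_has_derivative[OF g]]
  have "((\<lambda>t. g (X t) (Y t)) has_derivative
          (\<lambda>h. gx (X t) (Y t) * (X' * h) + gy (X t) (Y t) * (Y' * h))) (at t within S)"
    by simp
  then show ?thesis
    unfolding has_field_derivative_def by (rule has_derivative_eq_rhs) (simp add: fun_eq_iff algebra_simps)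
qed

lemma continuous_on_pair_compose:
  fixes g :: "real \<Rightarrow> real \<Rightarrow> real"
  assumes "continuous_on UNIV (\<lambda>z. g (fst z) (snd z))" "continuous_on A f" "continuous_on A h"
  shows "continuous_on A (\<lambda>x. g (f x) (h x))"
  using continuous_on_compose2[OF assms(1) continuous_on_Pair[OF assms(2,3)]] by simp

text \<open>Integrating \<^term>\<open>gy\<close> in the second variable and differentiating under the integral
  avoids the usual double difference quotient.\<close>

lemma mixed_partials_eq:
  assumes g: "has_C1_partials g gx gy"
    and gx: "has_C1_partials gx gxx gxy"
    and gy: "has_C1_partials gy gyx gyy"
  shows "gxy = gyx"
proof (intro ext)
  fix x y :: real
  \<comment> \<open>The base point lies strictly below \<open>y\<close>, so \<open>y\<close> is
    interior to \<open>{c..y+1}\<close> and the derivative within that interval is a full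
    derivative.\<close>
  define c where "c = y - 1"
  have cgy: "continuous_on A (gy x)" for A x
    by (intro continuous_on_pair_compose[OF has_C1_partials_continuous[OF gy]] continuous_intros)
  have cgyx: "continuous_on A (gyx x)" for A x
    by (intro continuous_on_pair_compose[OF has_C1_partialsD(3)[OF gy]] continuous_intros)
  have rep: "integral {c..v} (gy x) = g x v - g x c" if "c \<le> v" for x v
    by (intro integral_unique fundamental_theorem_of_calculus that)
       (use has_C1_partialsD(2)[OF g] in \<open>auto simp: has_real_derivative_iff_has_vector_derivative\<close>)
  have gx_rep: "gx x v = gx x c + integral {c..v} (gyx x)" if "c \<le> v" for v
  proof -
    have "((\<lambda>x. integral (cbox c v) (gy x)) has_real_derivative integral (cbox c v) (gyx x)) (at x)"
    proof (rule leibniz_rule_field_derivative)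
      show "continuous_on (UNIV \<times> cbox c v) (\<lambda>(x, t). gyx x t)"
        unfolding case_prod_beta' by (rule continuous_on_subset[OF has_C1_partialsD(3)[OF gy]]) simp
      show "gy x integrable_on cbox c v" for x
        using cgy by (rule integrable_continuous)
    qed (simp_all add: has_C1_partialsD(1)[OF gy])
    moreover have "((\<lambda>x. integral (cbox c v) (gy x)) has_real_derivative gx x v - gx x c) (at x)"
      unfolding cbox_interval rep[OF that]
      by (intro DERIV_diff has_C1_partialsD[OF g])
    ultimately have "integral (cbox c v) (gyx x) = gx x v - gx x c"
      by (rule DERIV_unique)
    then show ?thesis by simp
  qed
  have y: "y \<in> {c..y + 1}" "c < y" by (auto simp: c_def)
  have "((\<lambda>v. gx x c + integral {c..v} (gyx x)) has_real_derivative gyx x y) (at y within {c..y+1})"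
    by (rule DERIV_cong[OF DERIV_add[OF DERIV_const integral_has_real_derivative]])
       (use y cgyx in simp_all)
  then have "(gx x has_real_derivative gyx x y) (at y within {c..y+1})"
    by (rule has_field_derivative_transform_within[where d=1])
       (use y in \<open>auto simp: gx_rep[symmetric]\<close>)
  then have "(gx x has_real_derivative gyx x y) (at y)"
    using y by (simp add: at_within_Icc_at)
  with has_C1_partialsD(2)[OF gx] show "gxy x y = gyx x y"
    by (rule DERIV_unique)
qed

section \<open>Curried coordinates on the plane\<close>

definition cart :: "(real^2 \<Rightarrow> real) \<Rightarrow> real \<Rightarrow> real \<Rightarrow> real" where
  "cart f x y = f (vector [x, y])"

lemma continuous_on_cart:
  assumes "continuous_on UNIV f"
  shows "continuous_on UNIV (\<lambda>z. cart f (fst z) (snd z))"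
proof -
  have v: "(vector [x, y] :: real^2) = x *\<^sub>R axis 1 1 + y *\<^sub>R axis 2 1" for x y
    by (simp add: vec_eq_iff forall_2 axis_def)
  show ?thesis
    unfolding cart_def v by (intro continuous_on_compose2[OF assms] continuous_intros) auto
qed

lemma Ck_imp_continuous: "Ck k f \<Longrightarrow> continuous_on UNIV f"
  by (cases k) auto

text \<open>\<open>partial\<close> is built on the total operator \<open>deriv\<close>, which is
  meaningful only where a derivative exists; the differentiability clause of \<open>Ck\<close>
  supplies that. A shift then moves the base point from 0 to the actual coordinate.\<close>

lemma Ck_Suc_has_C1_partials:
  assumes "Ck (Suc k) f"
  shows "has_C1_partials (cart f) (cart (partial 1 f)) (cart (partial 2 f))"
proof -
  have d: "((\<lambda>t. f (x + t *\<^sub>R axis i 1)) has_real_derivative partial i f x) (at 0)" for i x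
    using assms by (auto simp: partial_def DERIV_deriv_iff_real_differentiable)
  have "((\<lambda>t. f (vector [t, y])) has_real_derivative partial 1 f (vector [x, y])) (at x)" for x y
  proof -
    have "(\<lambda>t. f (vector [x + t, y])) = (\<lambda>t. f (vector [x, y] + t *\<^sub>R axis 1 1))"
      by (intro ext arg_cong[where f=f]) (simp add: vec_eq_iff forall_2 axis_def)
    with d[of "vector [x, y]" 1] show ?thesis
      by (simp add: DERIV_shift[of _ _ 0 x, simplified] add.commute)
  qed
  moreover have "((\<lambda>t. f (vector [x, t])) has_real_derivative partial 2 f (vector [x, y])) (at y)" for x y
  proof -
    have "(\<lambda>t. f (vector [x, y + t])) = (\<lambda>t. f (vector [x, y] + t *\<^sub>R axis 2 1))"
      by (intro ext arg_cong[where f=f]) (simp add: vec_eq_iff forall_2 axis_def)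
    with d[of "vector [x, y]" 2] show ?thesis
      by (simp add: DERIV_shift[of _ _ 0 y, simplified] add.commute)
  qed
  moreover have "continuous_on UNIV (partial i f)" for i
    using assms Ck_imp_continuous[of k "partial i f"] by auto
  ultimately show ?thesis
    using continuous_on_cart unfolding has_C1_partials_def cart_def[abs_def] by auto
qed


section \<open>The Carleman estimate on a periodic strip\<close>

text \<open>The multipliers \<^term>\<open>a\<close> and \<^term>\<open>b\<close> are chosen so that, after substituting
  \<^term>\<open>us = v + m * u\<close>, the cross terms in \<^term>\<open>u * v\<close> cancel and the top order part of
  \<^term>\<open>u * f\<close> drops out. Here \<^term>\<open>m\<close> stands for a weight with derivative \<^term>\<open>- l\<close>,
  and \<^term>\<open>a'\<close>, \<^term>\<open>b'\<close> for the resulting derivatives of \<^term>\<open>a\<close>, \<^term>\<open>b\<close>.\<close>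

lemma carleman_pointwise:
  fixes l m M u us f a b a' b' :: real
  assumes lam: "0 \<le> l" and mu: "l / 2 \<le> m" and f: "\<bar>f\<bar> \<le> M * \<bar>u\<bar>"
    and a: "a = - l - 2 * m\<^sup>2" and b: "b = - 2 * l * m + 4 * m ^ 3"
    and a': "a' = 4 * l * m" and b': "b' = 2 * l\<^sup>2 - 12 * l * m\<^sup>2"
  shows "4 * a * us\<^sup>2 + 4 * m * us * f + 2 * a' * u * us + 2 * a * u * f + b' * u\<^sup>2
           + 2 * b * u * us - 2 * m * (2 * a * u * us + b * u\<^sup>2)
         \<le> - (l ^ 3 - 2 * l\<^sup>2 - 2 * l * M - M\<^sup>2 / 2) * u\<^sup>2" (is "?L \<le> _")
proof -
  define v where "v = us - m * u"
  have "?L = - 4 * (l + 2 * m\<^sup>2) * v\<^sup>2 + 4 * m * v * f - 2 * l * (u * f) + (2 * l\<^sup>2 - 4 * l * m\<^sup>2) * u\<^sup>2"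
    unfolding v_def a b a' b' by (simp add: power2_eq_square power3_eq_cube algebra_simps)
  moreover have "- 4 * (l + 2 * m\<^sup>2) * v\<^sup>2 + 4 * m * v * f \<le> f\<^sup>2 / 2"
  proof -
    \<comment> \<open>Completing the square: \<open>4 * m * v * f\<close> is absorbed by the
      \<open>-8 * m\<^sup>2 * v\<^sup>2\<close> contained in the first term, at the cost of
      \<open>f\<^sup>2 / 2\<close>.\<close>
    have "0 \<le> 4 * l * v\<^sup>2 + (4 * m * v - f)\<^sup>2 / 2" using lam by simp
    then show ?thesis by (simp add: power2_eq_square field_simps)
  qed
  moreover have "f\<^sup>2 \<le> M\<^sup>2 * u\<^sup>2"
    using power_mono[OF f, of 2] by (simp add: power_mult_distrib)
  moreover have "- 2 * l * (u * f) \<le> 2 * l * M * u\<^sup>2"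
  proof -
    have "- (u * f) \<le> \<bar>u\<bar> * \<bar>f\<bar>" by (metis abs_ge_minus_self abs_mult)
    also have "\<dots> \<le> \<bar>u\<bar> * (M * \<bar>u\<bar>)" by (intro mult_left_mono f) auto
    also have "\<dots> = M * u\<^sup>2" by (simp add: power2_eq_square)
    finally have "2 * l * (- (u * f)) \<le> 2 * l * (M * u\<^sup>2)" by (intro mult_left_mono) (use lam in auto)
    then show ?thesis by (simp add: mult.assoc)
  qed
  \<comment> \<open>This is the gain of the estimate: \<open>m \<ge> l / 2\<close> turns
    \<open>-4 * l * m\<^sup>2\<close> into a cubic negative term, which beats all other powers of
    \<open>l\<close> when \<open>l\<close> is large.\<close>
  moreover have "(2 * l\<^sup>2 - 4 * l * m\<^sup>2) * u\<^sup>2 \<le> (2 * l\<^sup>2 - l ^ 3) * u\<^sup>2"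
  proof -
    have "(l / 2)\<^sup>2 \<le> m\<^sup>2" using lam mu by (intro power_mono) auto
    then have "l * (l\<^sup>2) \<le> l * (4 * m\<^sup>2)" using lam by (intro mult_left_mono) (auto simp: power_divide)
    then show ?thesis by (intro mult_right_mono) (auto simp: power3_eq_cube power2_eq_square)
  qed
  ultimately show ?thesis by (simp add: algebra_simps)
qed

text \<open>Carleman estimate with the concave exponent \<^term>\<open>l * (s - s\<^sup>2 / 2)\<close>. No cutoff is needed: the
  boundary term at \<^term>\<open>T\<close> carries the weight \<^term>\<open>p T\<close>, which is exponentially smaller than
  the weight on \<^term>\<open>{0..T / 2}\<close> as \<^term>\<open>l\<close> grows.\<close>

lemma unique_continuation_strip:
  fixes U Us Ut Uss Ust Utt :: "real \<Rightarrow> real \<Rightarrow> real"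
  assumes T: "0 < T" "T \<le> 1 / 2" and L: "0 < L"
    and U: "has_C1_partials U Us Ut"
    and Us: "has_C1_partials Us Uss Ust"
    and Ut: "has_C1_partials Ut Ust Utt"
    and per: "\<And>s. U s L = U s 0" "\<And>s. Us s L = Us s 0" "\<And>s. Ut s L = Ut s 0"
    and bound: "\<And>s t. s \<in> {0..T} \<Longrightarrow> t \<in> {0..L} \<Longrightarrow> \<bar>Uss s t + Utt s t\<bar> \<le> M * \<bar>U s t\<bar>"
    and zero: "\<And>t. U 0 t = 0" "\<And>t. Us 0 t = 0"
    and st: "s \<in> {0..T / 2}" "t \<in> {0..L}"
  shows "U s t = 0"
proof -
  note cont = continuous_on_pair_compose[OF has_C1_partials_continuous[OF U]]
    continuous_on_pair_compose[OF has_C1_partials_continuous[OF Us]]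
    continuous_on_pair_compose[OF has_C1_partials_continuous[OF Ut]]
    continuous_on_pair_compose[OF has_C1_partialsD(3)[OF Us]]
    continuous_on_pair_compose[OF has_C1_partialsD(4)[OF Us]]
    continuous_on_pair_compose[OF has_C1_partialsD(4)[OF Ut]]
  have Ut0: "Ut 0 t = 0" for t
  proof -
    have "U 0 = (\<lambda>t. 0)" using zero by auto
    then have "((\<lambda>t. 0) has_real_derivative Ut 0 t) (at t)"
      using has_C1_partialsD(2)[OF U, of 0 t] by simp
    then show ?thesis using DERIV_const DERIV_unique by blast
  qed
  \<comment> \<open>\<open>H s\<close> is the squared L^2 norm of the slice at \<open>s\<close>, and
    \<open>J\<close> below accumulates it from 0. The aim is \<open>J (T / 2) = 0\<close>.\<close>
  define H where "H = (\<lambda>s. integral {0..L} (\<lambda>t. (U s t)\<^sup>2))"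
  have H_cont: "continuous_on A H" for A
    unfolding H_def cbox_interval[symmetric]
    by (rule integral_continuous_on_param) (unfold case_prod_beta', intro continuous_intros cont)
  have H_nonneg: "0 \<le> H s" for s
    unfolding H_def by (rule integral_nonneg) (auto intro!: integrable_continuous_interval continuous_intros cont)
  define J where "J = (\<lambda>s. integral {0..s} H)"
  have J_deriv: "(J has_real_derivative H s) (at s within {0..T})" if "s \<in> {0..T}" for s
    unfolding J_def using that H_cont by (intro integral_has_real_derivative)
  \<comment> \<open>A density free of \<open>l\<close> that dominates the terminal energy: its three
    coefficients match the bounds \<open>m \<le> l\<^sup>2\<close>,
    \<open>-a \<le> 3 * l\<^sup>2\<close> and \<open>-b \<le> 2 * l\<^sup>2\<close> at
    \<open>T\<close>.\<close>
  define q where "q = (\<lambda>t. 2 * (Ut T t)\<^sup>2 + 3 * ((U T t)\<^sup>2 + (Us T t)\<^sup>2) + 2 * (U T t)\<^sup>2)"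
  define C where "C = integral {0..L} q"
  have q_cont: "continuous_on A q" for A
    unfolding q_def by (intro continuous_intros cont)

  have main: "J (T / 2) \<le> C * (l\<^sup>2 * exp (- (T / 2) * l))"
    if l: "1 \<le> l" and K: "1 \<le> l ^ 3 - 2 * l\<^sup>2 - 2 * l * M - M\<^sup>2 / 2" for l
  proof -
    \<comment> \<open>\<open>m\<close> is the derivative of the exponent
      \<open>l * (s - s\<^sup>2 / 2)\<close> and \<open>p\<close> is the exponential of minus twice
      that exponent. Concavity enters as \<open>m' = -l\<close>, and \<open>T \<le> 1 / 2\<close>
      keeps \<open>m\<close> above \<open>l / 2\<close>.\<close>
    define m where "m = (\<lambda>s. l * (1 - s))"
    define p where "p = (\<lambda>s. exp (- 2 * l * (s - s\<^sup>2 / 2)))"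
    define a where "a = (\<lambda>s. - l - 2 * (m s)\<^sup>2)"
    define b where "b = (\<lambda>s. - 2 * l * m s + 4 * m s ^ 3)"
    define g where "g = (\<lambda>s t. p s * (2 * m s * ((Us s t)\<^sup>2 - (Ut s t)\<^sup>2)
        + 2 * a s * U s t * Us s t + b s * (U s t)\<^sup>2))"
    \<comment> \<open>The left side of \<open>carleman_pointwise\<close> with
      \<open>Uss + Utt\<close> for \<open>f\<close>; \<open>p * R\<close> is what the s-derivative
      of the energy density \<open>g\<close> leaves once a pure t-derivative is split off.\<close>
    define R where "R = (\<lambda>s t. 4 * a s * (Us s t)\<^sup>2 + 4 * m s * Us s t * (Uss s t + Utt s t)
        + 2 * (4 * l * m s) * U s t * Us s t + 2 * a s * U s t * (Uss s t + Utt s t)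
        + (2 * l\<^sup>2 - 12 * l * (m s)\<^sup>2) * (U s t)\<^sup>2 + 2 * b s * U s t * Us s t
        - 2 * m s * (2 * a s * U s t * Us s t + b s * (U s t)\<^sup>2))"
    \<comment> \<open>The flux in \<open>t\<close>. It is periodic, so its derivative
      \<open>Ft\<close> integrates to zero over \<open>{0..L}\<close>.\<close>
    define F where "F = (\<lambda>s t. - p s * (4 * m s * Ut s t * Us s t + 2 * a s * U s t * Ut s t))"
    define Ft where "Ft = (\<lambda>s t. - p s * (4 * m s * (Utt s t * Us s t + Ut s t * Ust s t)
        + 2 * a s * (Ut s t * Ut s t + U s t * Utt s t)))"
    have m_deriv: "(m has_real_derivative - l) (at s within S)" for s S
      unfolding m_def by (auto intro!: derivative_eq_intros)
    have p_deriv: "(p has_real_derivative - 2 * m s * p s) (at s within S)" for s S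
      unfolding p_def m_def by (auto intro!: derivative_eq_intros simp: algebra_simps)
    have a_deriv: "(a has_real_derivative 4 * l * m s) (at s within S)" for s S
      unfolding a_def by (auto intro!: derivative_eq_intros m_deriv)
    have b_deriv: "(b has_real_derivative 2 * l\<^sup>2 - 12 * l * (m s)\<^sup>2) (at s within S)" for s S
      unfolding b_def by (auto intro!: derivative_eq_intros m_deriv simp: power2_eq_square)
    note ders = m_deriv p_deriv a_deriv b_deriv
    have contc: "continuous_on A m" "continuous_on A p" "continuous_on A a" "continuous_on A b" for A
      by (rule DERIV_continuous_on, rule ders)+
    have m_le: "l / 2 \<le> m s" "m s \<le> l" if "s \<in> {0..T}" for s
      using that T l by (auto simp: m_def field_simps intro: mult_left_mono)
    \<comment> \<open>Differentiating \<open>2 * p * m\<close> gives \<open>2 * a * p\<close>, so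
      the squares of \<open>Ut\<close> cancel against those in \<open>Ft\<close> and
      \<open>R\<close> contains none.\<close>
    have g_deriv: "((\<lambda>s. g s t) has_real_derivative Ft s t + p s * R s t) (at s within S)" for s t S
      unfolding g_def
      by (rule DERIV_cong, (rule derivative_intros ders has_C1_partialsD(1)[OF U]
            has_C1_partialsD(1)[OF Us] has_C1_partialsD(1)[OF Ut])+)
         (simp add: Ft_def R_def a_def power2_eq_square algebra_simps)
    have F_deriv: "(F s has_real_derivative Ft s t) (at t within S)" for s t S
      unfolding F_def
      by (rule DERIV_cong, (rule derivative_intros has_C1_partialsD(2)[OF U]
            has_C1_partialsD(2)[OF Us] has_C1_partialsD(2)[OF Ut])+)
         (simp add: Ft_def algebra_simps)
    have R_le: "p s * R s t \<le> - (p s * (U s t)\<^sup>2)" if "s \<in> {0..T}" "t \<in> {0..L}" for s t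
    proof -
      have "R s t \<le> - (l ^ 3 - 2 * l\<^sup>2 - 2 * l * M - M\<^sup>2 / 2) * (U s t)\<^sup>2"
        unfolding R_def
        by (rule carleman_pointwise) (use that l m_le bound in \<open>auto simp: a_def b_def\<close>)
      also have "\<dots> \<le> - 1 * (U s t)\<^sup>2"
        using K by (intro mult_right_mono) auto
      finally have "p s * R s t \<le> p s * (- 1 * (U s t)\<^sup>2)"
        by (intro mult_left_mono) (auto simp: p_def)
      then show ?thesis by simp
    qed
    define G where "G = (\<lambda>s. integral {0..L} (g s))"
    have cpair: "continuous_on A (\<lambda>x. c (fst x))" if "\<And>B. continuous_on B c"
      for c :: "real \<Rightarrow> real" and A :: "(real \<times> real) set"
      by (rule continuous_on_compose2[OF that[of UNIV]]) (auto intro!: continuous_intros)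
    have G_deriv: "\<exists>D. (G has_real_derivative D) (at s within {0..T}) \<and> D \<le> - (p s * H s)"
      if s: "s \<in> {0..T}" for s
    proof (intro exI conjI)
      show "(G has_real_derivative integral {0..L} (\<lambda>t. Ft s t + p s * R s t)) (at s within {0..T})"
        unfolding G_def cbox_interval[of 0 L, symmetric]
      proof (rule leibniz_rule_field_derivative[where fx = "\<lambda>s t. Ft s t + p s * R s t"])
        show "g s integrable_on cbox 0 L" for s
          unfolding g_def by (intro integrable_continuous continuous_intros cont)
        show "continuous_on ({0..T} \<times> cbox 0 L) (\<lambda>(s, t). Ft s t + p s * R s t)"
          unfolding case_prod_beta' Ft_def R_def
          by (intro continuous_intros cont cpair contc)
      qed (use g_deriv s in auto)
      have Ft_int: "(Ft s has_integral F s L - F s 0) {0..L}"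
        by (rule fundamental_theorem_of_calculus)
           (use L F_deriv in \<open>auto simp: has_real_derivative_iff_has_vector_derivative[symmetric]\<close>)
      have F_per: "F s L = F s 0" by (simp add: F_def per)
      have R_int: "R s integrable_on {0..L}"
        unfolding R_def by (intro integrable_continuous_interval continuous_intros cont)
      have "integral {0..L} (\<lambda>t. Ft s t + p s * R s t) = integral {0..L} (\<lambda>t. p s * R s t)"
        using Ft_int F_per R_int
        by (subst integral_add) (auto simp: integral_unique has_integral_integrable intro: integrable_on_mult_right)
      also have "\<dots> \<le> integral {0..L} (\<lambda>t. - (p s * (U s t)\<^sup>2))"
        using R_int R_le s
        by (intro integral_le integrable_on_mult_right)
           (auto intro!: integrable_continuous_interval continuous_intros cont)
      also have "\<dots> = - (p s * H s)" by (simp add: H_def)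
      finally show "integral {0..L} (\<lambda>t. Ft s t + p s * R s t) \<le> - (p s * H s)" .
    qed
    have p_pos: "0 < p s" for s by (simp add: p_def)
    have G0: "G 0 = 0" by (simp add: G_def g_def zero Ut0)
    have G_cont: "continuous_on A G" if "A \<subseteq> {0..T}" for A
    proof (rule continuous_on_subset[OF _ that])
      show "continuous_on {0..T} G"
        unfolding continuous_on_eq_continuous_within
        using G_deriv DERIV_continuous by blast
    qed
    have J_cont: "continuous_on A J" if "A \<subseteq> {0..T}" for A
      by (rule continuous_on_subset[OF _ that]) (use J_deriv DERIV_continuous_on in blast)
    have p_mono: "p (T / 2) \<le> p s" if "s \<in> {0..T / 2}" for s
    proof -
      \<comment> \<open>The product is the difference of \<open>s - s\<^sup>2 / 2\<close> between
        \<open>T / 2\<close> and \<open>s\<close>, in factored form.\<close>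
      have "0 \<le> (T / 2 - s) * (1 - (T / 2 + s) / 2)" using that T by auto
      then have "s - s\<^sup>2 / 2 \<le> T / 2 - (T / 2)\<^sup>2 / 2" by (simp add: power2_eq_square field_simps)
      then show ?thesis using l by (simp add: p_def)
    qed
    have *: "\<exists>D. (G has_real_derivative D) (at s) \<and> D \<le> - (p s * H s)" if "0 < s" "s < T" for s
      using G_deriv[of s] that by (auto simp: at_within_Icc_at)
    \<comment> \<open>On the first half of the strip the decay of \<open>G\<close> pays for the
      growth of \<open>J\<close>, because the weight there is at least
      \<open>p (T / 2)\<close>.\<close>
    have "G (T / 2) + p (T / 2) * J (T / 2) \<le> G 0 + p (T / 2) * J 0"
    proof (rule DERIV_nonpos_imp_decreasing_open[of 0 "T/2" "\<lambda>s. G s + p (T / 2) * J s"])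
      fix s assume s: "0 < s" "s < T / 2"
      then obtain D where D: "(G has_real_derivative D) (at s)" "D \<le> - (p s * H s)"
        using *[of s] T by auto
      have "(J has_real_derivative H s) (at s)"
        using J_deriv[of s] s T by (simp add: at_within_Icc_at)
      then have "((\<lambda>s. G s + p (T / 2) * J s) has_real_derivative D + p (T / 2) * H s) (at s)"
        using D by (intro DERIV_add DERIV_cmult)
      moreover have "p (T / 2) * H s \<le> p s * H s"
        using s by (intro mult_right_mono p_mono H_nonneg) auto
      ultimately show "\<exists>y. ((\<lambda>s. G s + p (T / 2) * J s) has_real_derivative y) (at s) \<and> y \<le> 0"
        using D by (intro exI[of _ "D + p (T / 2) * H s"]) auto
    qed (use T in \<open>auto intro!: continuous_intros G_cont J_cont\<close>)
    moreover have "J 0 = 0" by (simp add: J_def)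
    moreover have "G T \<le> G (T / 2)"
    proof (rule DERIV_nonpos_imp_decreasing_open[of "T / 2" T G])
      fix s assume s: "T / 2 < s" "s < T"
      then obtain D where D: "(G has_real_derivative D) (at s)" "D \<le> - (p s * H s)"
        using *[of s] T by auto
      moreover have "0 \<le> p s * H s" using p_pos[of s] H_nonneg[of s] by simp
      ultimately show "\<exists>y. (G has_real_derivative y) (at s) \<and> y \<le> 0" by force
    qed (use T in \<open>auto intro!: G_cont\<close>)
    \<comment> \<open>No data are prescribed at \<open>T\<close>; the terminal energy is only
      bounded below, with quadratic growth in \<open>l\<close> apart from the small weight
      \<open>p T\<close>.\<close>
    moreover have "- (p T * l\<^sup>2 * C) \<le> G T"
    proof -
      have "- (p T * l\<^sup>2) * q t \<le> g T t" for t
      proof -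
        have m: "0 \<le> m T" "m T \<le> l" using m_le[of T] T l by auto
        have l2: "l \<le> l\<^sup>2" using l by (simp add: power2_eq_square)
        have m2: "(m T)\<^sup>2 \<le> l\<^sup>2" using m by (intro power_mono)
        have "- (2 * l\<^sup>2 * (Ut T t)\<^sup>2) \<le> 2 * m T * ((Us T t)\<^sup>2 - (Ut T t)\<^sup>2)"
        proof -
          have "m T * (Ut T t)\<^sup>2 \<le> l\<^sup>2 * (Ut T t)\<^sup>2" using m l2 by (intro mult_right_mono) auto
          moreover have "0 \<le> m T * (Us T t)\<^sup>2" using m by simp
          ultimately show ?thesis by (simp add: algebra_simps)
        qed
        moreover have "- (3 * l\<^sup>2 * ((U T t)\<^sup>2 + (Us T t)\<^sup>2)) \<le> 2 * a T * U T t * Us T t"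
        proof -
          have "2 * (U T t * Us T t) \<le> (U T t)\<^sup>2 + (Us T t)\<^sup>2"
            using sum_squares_bound[of "U T t" "Us T t"] by (simp add: mult.assoc)
          then have "- a T * (2 * (U T t * Us T t)) \<le> - a T * ((U T t)\<^sup>2 + (Us T t)\<^sup>2)"
            using l by (intro mult_left_mono) (auto simp: a_def)
          also have "\<dots> \<le> 3 * l\<^sup>2 * ((U T t)\<^sup>2 + (Us T t)\<^sup>2)"
            using l2 m2 by (intro mult_right_mono) (auto simp: a_def)
          finally show ?thesis by (simp add: algebra_simps)
        qed
        moreover have "- (2 * l\<^sup>2 * (U T t)\<^sup>2) \<le> b T * (U T t)\<^sup>2"
        proof -
          have "l * m T \<le> l * l" using m l by (intro mult_left_mono) auto
          moreover have "0 \<le> m T ^ 3" using m by simp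
          ultimately have "- (2 * l\<^sup>2) \<le> b T" unfolding b_def power2_eq_square by linarith
          from mult_right_mono[OF this, of "(U T t)\<^sup>2"] show ?thesis by simp
        qed
        ultimately have "- (l\<^sup>2 * q t) \<le> 2 * m T * ((Us T t)\<^sup>2 - (Ut T t)\<^sup>2)
            + 2 * a T * U T t * Us T t + b T * (U T t)\<^sup>2"
          by (simp add: q_def algebra_simps)
        from mult_left_mono[OF this, of "p T"] p_pos[of T] show ?thesis
          by (simp add: g_def mult.assoc)
      qed
      then have "integral {0..L} (\<lambda>t. - (p T * l\<^sup>2) * q t) \<le> G T"
        unfolding G_def
        by (intro integral_le) (auto simp: g_def intro!: integrable_continuous_interval continuous_intros cont q_cont)
      then show ?thesis by (simp add: C_def)
    qed
    ultimately have "p (T / 2) * J (T / 2) \<le> p T * l\<^sup>2 * C" using G0 by simp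
    then have "J (T / 2) \<le> p T / p (T / 2) * (l\<^sup>2 * C)"
      using p_pos[of "T / 2"] by (simp add: field_simps)
    also have "\<dots> \<le> exp (- (T / 2) * l) * (l\<^sup>2 * C)"
    proof (rule mult_right_mono)
      \<comment> \<open>The exponents differ by \<open>T / 2 - 3 / 8 * T\<^sup>2\<close>, which is
        at least \<open>T / 4\<close> for \<open>T \<le> 1 / 2\<close>.\<close>
      have "p T / p (T / 2) = exp (- 2 * l * (T / 2 - 3 / 8 * T\<^sup>2))"
        by (simp add: p_def exp_diff[symmetric] power2_eq_square field_simps)
      also have "\<dots> \<le> exp (- (T / 2) * l)"
      proof -
        have "T * T \<le> 1 / 2 * T" using T by (intro mult_right_mono) auto
        then have "T / 4 \<le> T / 2 - 3 / 8 * T\<^sup>2" using T by (simp add: power2_eq_square)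
        then have "l * (T / 4) \<le> l * (T / 2 - 3 / 8 * T\<^sup>2)" using l by (intro mult_left_mono) auto
        then show ?thesis by (simp add: algebra_simps)
      qed
      finally show "p T / p (T / 2) \<le> exp (- (T / 2) * l)" .
      have "0 \<le> C" unfolding C_def
        by (intro integral_nonneg integrable_continuous_interval q_cont) (auto simp: q_def)
      then show "0 \<le> l\<^sup>2 * C" by simp
    qed
    finally show ?thesis by (simp add: mult_ac)
  qed
  have "((\<lambda>l. C * (l\<^sup>2 * exp (- (T / 2) * l))) \<longlongrightarrow> C * 0) at_top"
  proof (intro tendsto_intros)
    have "filterlim (\<lambda>l. T / 2 * l) at_top at_top"
      using T by (intro filterlim_tendsto_pos_mult_at_top[OF tendsto_const] filterlim_ident) auto
    from filterlim_compose[OF tendsto_power_div_exp_0[of 2] this]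
    have "((\<lambda>l. (2 / T)\<^sup>2 * ((T / 2 * l)\<^sup>2 / exp (T / 2 * l))) \<longlongrightarrow> (2 / T)\<^sup>2 * 0) at_top"
      by (intro tendsto_intros)
    then show "((\<lambda>l. l\<^sup>2 * exp (- (T / 2) * l)) \<longlongrightarrow> 0) at_top"
      using T by (simp add: power_divide power_mult_distrib exp_minus field_simps)
  qed
  moreover have "\<forall>\<^sub>F l in at_top. J (T / 2) \<le> C * (l\<^sup>2 * exp (- (T / 2) * l))"
    \<comment> \<open>The threshold gives
      \<open>l - 2 \<ge> 2 + 2 * \<bar>M\<bar> + M\<^sup>2 / 2\<close>, enough for the cubic term to
      absorb the rest and leave at least 1.\<close>
    using eventually_ge_at_top[of "4 + 2 * \<bar>M\<bar> + M\<^sup>2 / 2"]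
  proof eventually_elim
    case (elim l)
    moreover have "0 \<le> M\<^sup>2 / 2" by simp
    ultimately have l: "4 \<le> l" by linarith
    have "l * (2 + 2 * \<bar>M\<bar> + M\<^sup>2 / 2) \<le> l * (l - 2)"
      using l elim by (intro mult_left_mono) auto
    also have "\<dots> \<le> l * (l * (l - 2))"
      using mult_right_mono[of 1 l "l * (l - 2)"] l by simp
    finally have "2 * l + 2 * (l * \<bar>M\<bar>) + l * (M\<^sup>2 / 2) \<le> l ^ 3 - 2 * l\<^sup>2"
      by (simp add: power2_eq_square power3_eq_cube algebra_simps)
    moreover have "1 * (M\<^sup>2 / 2) \<le> l * (M\<^sup>2 / 2)" using l by (intro mult_right_mono) auto
    moreover have "l * M \<le> l * \<bar>M\<bar>" using l by (intro mult_left_mono) auto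
    ultimately have "1 \<le> l ^ 3 - 2 * l\<^sup>2 - 2 * l * M - M\<^sup>2 / 2"
      using l by (simp only: mult.assoc)
    then show ?case using l by (intro main) auto
  qed
  ultimately have "J (T / 2) \<le> C * 0"
    by (rule tendsto_lowerbound) simp
  then have "J (T / 2) \<le> 0" by simp
  moreover have "0 \<le> J (T / 2)"
    unfolding J_def by (intro integral_nonneg integrable_continuous_interval H_cont H_nonneg)
  ultimately have "integral {0..T / 2} H = 0" by (simp add: J_def)
  then have "H s = 0"
    using integral_eq_0_iff[OF H_cont] T st H_nonneg by auto
  then have "(U s t)\<^sup>2 = 0"
    unfolding H_def using L st
    by (subst (asm) integral_eq_0_iff) (auto intro!: continuous_intros cont)
  then show ?thesis by simp
qed

section \<open>Closure rules and logarithmic polar coordinates\<close>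

text \<open>Separates computing partials from their final shape: the closure rules produce some
  expression, and algebra then matches it with the prescribed closed form.\<close>

lemma has_C1_partials_cong:
  "has_C1_partials g gx gy \<Longrightarrow> (\<And>x y. gx x y = gx' x y) \<Longrightarrow> (\<And>x y. gy x y = gy' x y)
    \<Longrightarrow> has_C1_partials g gx' gy'"
  unfolding has_C1_partials_def by simp

lemma has_C1_partials_fst: "has_C1_partials (\<lambda>x y. x) (\<lambda>x y. 1) (\<lambda>x y. 0)"
  unfolding has_C1_partials_def by (auto intro!: derivative_eq_intros continuous_intros)

lemma has_C1_partials_snd: "has_C1_partials (\<lambda>x y. y) (\<lambda>x y. 0) (\<lambda>x y. 1)"
  unfolding has_C1_partials_def by (auto intro!: derivative_eq_intros continuous_intros)

lemma has_C1_partials_const: "has_C1_partials (\<lambda>x y. c) (\<lambda>x y. 0) (\<lambda>x y. 0)"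
  unfolding has_C1_partials_def by (auto intro!: derivative_eq_intros continuous_intros)

lemma has_C1_partials_add:
  assumes "has_C1_partials f fx fy" "has_C1_partials g gx gy"
  shows "has_C1_partials (\<lambda>x y. f x y + g x y) (\<lambda>x y. fx x y + gx x y) (\<lambda>x y. fy x y + gy x y)"
  using assms unfolding has_C1_partials_def by (auto intro!: DERIV_add continuous_on_add)

lemma has_C1_partials_diff:
  assumes "has_C1_partials f fx fy" "has_C1_partials g gx gy"
  shows "has_C1_partials (\<lambda>x y. f x y - g x y) (\<lambda>x y. fx x y - gx x y) (\<lambda>x y. fy x y - gy x y)"
  using assms unfolding has_C1_partials_def by (auto intro!: DERIV_diff continuous_on_diff)

lemma has_C1_partials_mult:
  assumes "has_C1_partials f fx fy" "has_C1_partials g gx gy"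
  shows "has_C1_partials (\<lambda>x y. f x y * g x y)
           (\<lambda>x y. fx x y * g x y + gx x y * f x y) (\<lambda>x y. fy x y * g x y + gy x y * f x y)"
  using assms has_C1_partials_continuous[OF assms(1)] has_C1_partials_continuous[OF assms(2)]
  unfolding has_C1_partials_def
  by (auto intro!: DERIV_mult continuous_on_add continuous_on_mult)

lemma has_C1_partials_compose:
  assumes g: "has_C1_partials g gx gy"
    and X: "has_C1_partials X Xs Xt" and Y: "has_C1_partials Y Ys Yt"
  shows "has_C1_partials (\<lambda>s t. g (X s t) (Y s t))
           (\<lambda>s t. gx (X s t) (Y s t) * Xs s t + gy (X s t) (Y s t) * Ys s t)
           (\<lambda>s t. gx (X s t) (Y s t) * Xt s t + gy (X s t) (Y s t) * Yt s t)"
  unfolding has_C1_partials_def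
  by (intro conjI allI has_C1_partials_chain[OF g] has_C1_partialsD[OF X] has_C1_partialsD[OF Y]
      continuous_on_add continuous_on_mult
      continuous_on_pair_compose[OF has_C1_partialsD(3)[OF g]]
      continuous_on_pair_compose[OF has_C1_partialsD(4)[OF g]]
      has_C1_partials_continuous[OF X] has_C1_partials_continuous[OF Y])

lemmas has_C1_partials_intros =
  has_C1_partials_add has_C1_partials_diff has_C1_partials_mult
  has_C1_partials_fst has_C1_partials_snd has_C1_partials_const

text \<open>In logarithmic polar coordinates the Laplacian becomes the flat one up to the factor
  \<^term>\<open>x\<^sup>2 + y\<^sup>2\<close>; the sign \<^term>\<open>\<sigma>\<close> selects the outer or the inner side of the circle.\<close>

lemma unique_continuation_circle:
  fixes u ux uy uxx uxy uyy :: "real \<Rightarrow> real \<Rightarrow> real"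
  assumes T: "0 < T" "T \<le> 1 / 2" and \<sigma>: "\<sigma> = 1 \<or> \<sigma> = -1"
    and u: "has_C1_partials u ux uy"
    and ux: "has_C1_partials ux uxx uxy"
    and uy: "has_C1_partials uy uxy uyy"
    and bound: "\<And>s t x y. \<lbrakk>\<bar>s\<bar> \<le> T; t \<in> {0..2 * pi}; x = r * exp s * cos t; y = r * exp s * sin t\<rbrakk>
      \<Longrightarrow> \<bar>(x\<^sup>2 + y\<^sup>2) * (uxx x y + uyy x y)\<bar> \<le> M * \<bar>u x y\<bar>"
    and zero: "\<And>t. u (r * cos t) (r * sin t) = 0"
      "\<And>x y t. \<lbrakk>x = r * cos t; y = r * sin t\<rbrakk> \<Longrightarrow> x * ux x y + y * uy x y = 0"
    and s: "s \<in> {0..T / 2}" and t: "t \<in> {0..2 * pi}"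
  shows "u (r * exp (\<sigma> * s) * cos t) (r * exp (\<sigma> * s) * sin t) = 0"
proof -
  have \<sigma>2: "\<sigma> * \<sigma> = 1" using \<sigma> by auto
  define X where "X = (\<lambda>s t. r * exp (\<sigma> * s) * cos t)"
  define Y where "Y = (\<lambda>s t. r * exp (\<sigma> * s) * sin t)"
  have X: "has_C1_partials X (\<lambda>s t. \<sigma> * X s t) (\<lambda>s t. - Y s t)"
    unfolding has_C1_partials_def X_def Y_def
    by (auto intro!: derivative_eq_intros continuous_intros)
  have Y: "has_C1_partials Y (\<lambda>s t. \<sigma> * Y s t) X"
    unfolding has_C1_partials_def X_def Y_def
    by (auto intro!: derivative_eq_intros continuous_intros)
  define U where "U = (\<lambda>s t. u (X s t) (Y s t))"
  define Us where "Us = (\<lambda>s t. \<sigma> * (X s t * ux (X s t) (Y s t) + Y s t * uy (X s t) (Y s t)))"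
  define Ut where "Ut = (\<lambda>s t. X s t * uy (X s t) (Y s t) - Y s t * ux (X s t) (Y s t))"
  \<comment> \<open>Two differentiations in \<open>s\<close> contribute
    \<open>\<sigma> * \<sigma> = 1\<close>, so the sign survives only in \<open>Us\<close> and
    \<open>Ust\<close>.\<close>
  define Uss where "Uss = (\<lambda>s t. X s t * ux (X s t) (Y s t) + Y s t * uy (X s t) (Y s t)
     + (X s t)\<^sup>2 * uxx (X s t) (Y s t) + 2 * X s t * Y s t * uxy (X s t) (Y s t) + (Y s t)\<^sup>2 * uyy (X s t) (Y s t))"
  define Utt where "Utt = (\<lambda>s t. - X s t * ux (X s t) (Y s t) - Y s t * uy (X s t) (Y s t)
     + (Y s t)\<^sup>2 * uxx (X s t) (Y s t) - 2 * X s t * Y s t * uxy (X s t) (Y s t) + (X s t)\<^sup>2 * uyy (X s t) (Y s t))"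
  define Ust where "Ust = (\<lambda>s t. \<sigma> * (X s t * uy (X s t) (Y s t) - Y s t * ux (X s t) (Y s t)
     + X s t * Y s t * (uyy (X s t) (Y s t) - uxx (X s t) (Y s t))
     + ((X s t)\<^sup>2 - (Y s t)\<^sup>2) * uxy (X s t) (Y s t)))"
  note rules = has_C1_partials_intros X Y has_C1_partials_compose[OF u X Y]
    has_C1_partials_compose[OF ux X Y] has_C1_partials_compose[OF uy X Y]
  have U: "has_C1_partials U Us Ut"
    unfolding U_def
    by (rule has_C1_partials_cong, (rule rules)+) (auto simp: Us_def Ut_def algebra_simps)
  have Us: "has_C1_partials Us Uss Ust"
    unfolding Us_def
    by (rule has_C1_partials_cong, (rule rules)+)
       (use \<sigma> in \<open>auto simp: Uss_def Ust_def power2_eq_square algebra_simps\<close>)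
  have Ut: "has_C1_partials Ut Ust Utt"
    unfolding Ut_def
    by (rule has_C1_partials_cong, (rule rules)+)
       (auto simp: Utt_def Ust_def power2_eq_square algebra_simps)
  have sig_abs: "\<bar>\<sigma> * s\<bar> = \<bar>s\<bar>" for s using \<sigma> by auto
  have per: "X s (2 * pi) = X s 0" "Y s (2 * pi) = Y s 0" for s by (simp_all add: X_def Y_def)
  have X0: "X 0 t = r * cos t" "Y 0 t = r * sin t" for t by (simp_all add: X_def Y_def)
  have "U s t = 0"
  proof (rule unique_continuation_strip[OF T _ U Us Ut])
    show "\<bar>Uss s t + Utt s t\<bar> \<le> M * \<bar>U s t\<bar>" if "s \<in> {0..T}" "t \<in> {0..2 * pi}" for s t
    proof -
      \<comment> \<open>The first-order terms and the mixed terms of \<open>Uss\<close> and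
        \<open>Utt\<close> cancel.\<close>
      have "Uss s t + Utt s t = ((X s t)\<^sup>2 + (Y s t)\<^sup>2) * (uxx (X s t) (Y s t) + uyy (X s t) (Y s t))"
        by (simp add: Uss_def Utt_def algebra_simps)
      then show ?thesis
        using bound[of "\<sigma> * s" t "X s t" "Y s t"] that
        by (simp add: sig_abs U_def X_def Y_def)
    qed
    show "U 0 t = 0" for t by (simp add: U_def X0 zero)
    show "Us 0 t = 0" for t
      using zero(2)[OF refl refl, of t] by (simp add: Us_def X0)
  qed (use s t in \<open>auto simp: U_def Us_def Ut_def per\<close>)
  then show ?thesis by (simp add: U_def X_def Y_def)
qed

section \<open>Circles on which the function is constant\<close>

text \<open>The second condition says that the derivative along the parametrised circle vanishes, by
  the chain rule.\<close>

lemma circle_values_eq_iff: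
  fixes p px py :: "real \<Rightarrow> real \<Rightarrow> real"
  assumes p: "has_C1_partials p px py"
  shows "(\<forall>t t'. p (\<rho> * cos t) (\<rho> * sin t) = p (\<rho> * cos t') (\<rho> * sin t')) \<longleftrightarrow>
     (\<forall>t. \<rho> * cos t * py (\<rho> * cos t) (\<rho> * sin t) - \<rho> * sin t * px (\<rho> * cos t) (\<rho> * sin t) = 0)"
    (is "?const \<longleftrightarrow> (\<forall>t. ?u t = 0)")
proof -
  have d: "((\<lambda>t. p (\<rho> * cos t) (\<rho> * sin t)) has_real_derivative ?u t) (at t)" for t
    by (rule DERIV_cong, rule has_C1_partials_chain[OF p]) (auto intro!: derivative_eq_intros)
  show ?thesis
  proof
    assume c: ?const
    show "\<forall>t. ?u t = 0"
    proof
      fix t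
      have "(\<lambda>t. p (\<rho> * cos t) (\<rho> * sin t)) = (\<lambda>_. p (\<rho> * cos 0) (\<rho> * sin 0))"
        using c by blast
      with d[of t] have "((\<lambda>_. p (\<rho> * cos 0) (\<rho> * sin 0)) has_real_derivative ?u t) (at t)"
        by metis
      then show "?u t = 0" using DERIV_const DERIV_unique by blast
    qed
  next
    assume "\<forall>t. ?u t = 0"
    with d have "\<forall>t. ((\<lambda>t. p (\<rho> * cos t) (\<rho> * sin t)) has_real_derivative 0) (at t)" by metis
    then show ?const by (intro allI) (rule DERIV_isconst_all)
  qed
qed

text \<open>Limits are taken along \<open>I\<close> only: continuity gives \<open>q r = 0\<close>
  without assuming \<open>r \<in> I\<close>, and then every difference quotient along
  \<open>I\<close> is zero.\<close>

lemma zero_deriv_if_islimpt_zeros: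
  fixes q :: "real \<Rightarrow> real"
  assumes q: "(q has_real_derivative D) (at r)" and lim: "r islimpt I" and zero: "\<And>y. y \<in> I \<Longrightarrow> q y = 0"
  shows "q r = 0" "D = 0"
proof -
  have nontriv: "at r within I \<noteq> bot" using lim by (simp add: trivial_limit_within)
  have ev: "\<forall>\<^sub>F y in at r within I. q y = 0"
    using zero by (auto simp: eventually_at intro!: exI[of _ 1])
  have "(q \<longlongrightarrow> q r) (at r within I)"
    by (rule tendsto_within_subset[OF DERIV_isCont[OF q, unfolded isCont_def] subset_UNIV])
  then show qr: "q r = 0"
    by (rule tendsto_unique[OF nontriv]) (rule tendsto_eventually[OF ev])
  have "((\<lambda>y. (q y - q r) / (y - r)) \<longlongrightarrow> D) (at r within I)"
    using has_field_derivative_at_within[OF q] by (simp add: has_field_derivative_iff)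
  moreover have "\<forall>\<^sub>F y in at r within I. (q y - q r) / (y - r) = 0"
    using ev by eventually_elim (simp add: qr)
  ultimately show "D = 0"
    by (blast intro: tendsto_unique[OF nontriv] tendsto_eventually)
qed

text \<open>The contrapositive core of the theorem. Mixed third partials share names, so their
  symmetry is part of the hypotheses on \<open>pxx\<close>, \<open>pxy\<close> and
  \<open>pyy\<close>.\<close>

lemma circles_constant_near:
  fixes p px py pxx pxy pyy pxxx pxxy pxyy pyyy :: "real \<Rightarrow> real \<Rightarrow> real"
  defines "I \<equiv> {\<rho>. 0 \<le> \<rho> \<and> (\<forall>t t'. p (\<rho> * cos t) (\<rho> * sin t) = p (\<rho> * cos t') (\<rho> * sin t'))}"
  assumes p: "has_C1_partials p px py"
    and px: "has_C1_partials px pxx pxy" and py: "has_C1_partials py pxy pyy"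
    and pxx: "has_C1_partials pxx pxxx pxxy" and pxy: "has_C1_partials pxy pxxy pxyy"
    and pyy: "has_C1_partials pyy pxyy pyyy"
    and euler: "\<And>x y. px x y * (pxxy x y + pyyy x y) = py x y * (pxxx x y + pxyy x y)"
    and r: "0 < r" and lim: "r islimpt I"
    and grad: "px (r * cos t0) (r * sin t0) \<noteq> 0 \<or> py (r * cos t0) (r * sin t0) \<noteq> 0"
  shows "\<exists>e>0. \<forall>\<rho>. \<bar>\<rho> - r\<bar> < e \<longrightarrow> 0 \<le> \<rho> \<longrightarrow> \<rho> \<in> I"
proof -
  define u where "u = (\<lambda>x y. x * py x y - y * px x y)"
  define ux where "ux = (\<lambda>x y. py x y + x * pxy x y - y * pxx x y)"
  define uy where "uy = (\<lambda>x y. x * pyy x y - px x y - y * pxy x y)"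
  define uxx where "uxx = (\<lambda>x y. 2 * pxy x y + x * pxxy x y - y * pxxx x y)"
  define uxy where "uxy = (\<lambda>x y. pyy x y + x * pxyy x y - pxx x y - y * pxxy x y)"
  define uyy where "uyy = (\<lambda>x y. x * pyyy x y - 2 * pxy x y - y * pxyy x y)"
  \<comment> \<open>\<open>W\<close> is the radius times the radial derivative of \<open>p\<close>;
    \<open>Lx\<close> and \<open>Ly\<close> form the gradient of its Laplacian.\<close>
  define W where "W = (\<lambda>x y. x * px x y + y * py x y)"
  define Lx where "Lx = (\<lambda>x y. pxxx x y + pxyy x y)"
  define Ly where "Ly = (\<lambda>x y. pxxy x y + pyyy x y)"
  note rules = has_C1_partials_intros p px py pxx pxy pyy
  have u: "has_C1_partials u ux uy"
    unfolding u_def by (rule has_C1_partials_cong, (rule rules)+) (auto simp: ux_def uy_def)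
  have ux: "has_C1_partials ux uxx uxy"
    unfolding ux_def by (rule has_C1_partials_cong, (rule rules)+) (auto simp: uxx_def uxy_def)
  have uy: "has_C1_partials uy uxy uyy"
    unfolding uy_def by (rule has_C1_partials_cong, (rule rules)+) (auto simp: uxy_def uyy_def)
  have W: "has_C1_partials W (\<lambda>x y. px x y + x * pxx x y + y * pxy x y)
                             (\<lambda>x y. py x y + x * pxy x y + y * pyy x y)"
    unfolding W_def by (rule has_C1_partials_cong, (rule rules)+) auto
  have I_iff: "\<rho> \<in> I \<longleftrightarrow> 0 \<le> \<rho> \<and> (\<forall>t. u (\<rho> * cos t) (\<rho> * sin t) = 0)" for \<rho>
    unfolding I_def u_def using circle_values_eq_iff[OF p, of \<rho>] by simp

  have q: "((\<lambda>\<rho>. u (\<rho> * cos t) (\<rho> * sin t)) has_real_derivative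
      cos t * ux (r * cos t) (r * sin t) + sin t * uy (r * cos t) (r * sin t)) (at r)" for t
    by (rule DERIV_cong, rule has_C1_partials_chain[OF u]) (auto intro!: derivative_eq_intros)
  have u0: "u (r * cos t) (r * sin t) = 0" for t
    by (rule zero_deriv_if_islimpt_zeros(1)[OF q lim]) (simp add: I_iff)
  have us0: "x * ux x y + y * uy x y = 0" if "x = r * cos t" "y = r * sin t" for x y t
  proof -
    have "cos t * ux (r * cos t) (r * sin t) + sin t * uy (r * cos t) (r * sin t) = 0"
      by (rule zero_deriv_if_islimpt_zeros(2)[OF q lim]) (simp add: I_iff)
    then have "r * (cos t * ux x y + sin t * uy x y) = 0" using that by simp
    then show ?thesis using that by (simp add: algebra_simps)
  qed

  define c where "c = W (r * cos t0) (r * sin t0)"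
  \<comment> \<open>Rotations commute with dilations, so the angular derivative of \<open>W\<close>
    equals \<open>x * ux + y * uy\<close>, which vanishes on the circle by
    \<open>us0\<close>.\<close>
  have W_const: "W (r * cos t) (r * sin t) = c" for t
  proof -
    have "((\<lambda>t. W (r * cos t) (r * sin t)) has_real_derivative 0) (at t)" for t
    proof (rule DERIV_cong, rule has_C1_partials_chain[OF W])
      show "((\<lambda>t. r * cos t) has_real_derivative - (r * sin t)) (at t)"
        and "((\<lambda>t. r * sin t) has_real_derivative r * cos t) (at t)"
        by (auto intro!: derivative_eq_intros)
      define x y where "x = r * cos t" and "y = r * sin t"
      show "(px (r * cos t) (r * sin t) + r * cos t * pxx (r * cos t) (r * sin t)
            + r * sin t * pxy (r * cos t) (r * sin t)) * - (r * sin t)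
          + (py (r * cos t) (r * sin t) + r * cos t * pxy (r * cos t) (r * sin t)
            + r * sin t * pyy (r * cos t) (r * sin t)) * (r * cos t) = 0"
        unfolding x_def[symmetric] y_def[symmetric]
        using us0[OF x_def y_def] by (simp add: ux_def uy_def algebra_simps)
    qed
    then show ?thesis unfolding c_def by (intro DERIV_isconst_all) blast
  qed
  have "c \<noteq> 0"
  proof
    assume "c = 0"
    define x y where "x = r * cos t0" and "y = r * sin t0"
    \<comment> \<open>Radial and angular parts both vanish, a linear system for the gradient with
      determinant \<open>r\<^sup>2\<close>.\<close>
    have "x * px x y + y * py x y = 0" "x * py x y - y * px x y = 0"
      using \<open>c = 0\<close> u0[of t0] unfolding c_def W_def u_def x_def y_def by auto
    then have "(x\<^sup>2 + y\<^sup>2) * px x y = 0" "(x\<^sup>2 + y\<^sup>2) * py x y = 0" by algebra+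
    moreover have "x\<^sup>2 + y\<^sup>2 = r\<^sup>2"
      unfolding x_def y_def by (simp add: power_mult_distrib flip: distrib_left)
    ultimately show False using grad r by (auto simp: x_def y_def)
  qed

  define polar :: "real \<times> real \<Rightarrow> real \<times> real"
    where "polar = (\<lambda>z. (r * exp (fst z) * cos (snd z), r * exp (fst z) * sin (snd z)))"
  have cont_polar: "continuous_on A (\<lambda>z. f (fst (polar z)) (snd (polar z)))"
    if "continuous_on UNIV (\<lambda>z. f (fst z) (snd z))" for f :: "real \<Rightarrow> real \<Rightarrow> real" and A
    unfolding polar_def fst_conv snd_conv
    by (intro continuous_on_pair_compose[OF that] continuous_intros)
  define N where "N = (\<lambda>z. W (fst (polar z)) (snd (polar z)))"
  have N_cont: "continuous_on A N" for A
    unfolding N_def by (intro cont_polar has_C1_partials_continuous[OF W])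
  \<comment> \<open>One \<open>d\<close> must serve all angles, which compactness provides. With
    tolerance \<open>\<bar>c\<bar>\<close> around the value \<open>c\<close> at
    \<open>s = 0\<close>, \<open>N\<close> cannot reach zero.\<close>
  have "uniformly_continuous_on ({-1..1} \<times> {0..2 * pi}) N"
    by (intro compact_uniformly_continuous N_cont compact_Times compact_Icc)
  from this[unfolded uniformly_continuous_on_def, rule_format, of "\<bar>c\<bar>"] \<open>c \<noteq> 0\<close>
  obtain d where d: "0 < d" and
    close: "\<And>z z'. \<lbrakk>z \<in> {-1..1} \<times> {0..2 * pi}; z' \<in> {-1..1} \<times> {0..2 * pi}; dist z' z < d\<rbrakk>
              \<Longrightarrow> dist (N z') (N z) < \<bar>c\<bar>"
    by auto
  define T where "T = min (1 / 2) (d / 2)"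
  have T: "0 < T" "T \<le> 1 / 2" "T < d" using d by (auto simp: T_def)
  have N_nz: "N (s, t) \<noteq> 0" if "\<bar>s\<bar> \<le> T" "t \<in> {0..2 * pi}" for s t
  proof
    assume "N (s, t) = 0"
    moreover have "N (0, t) = c" by (simp add: N_def polar_def W_const)
    moreover have "dist (s, t) (0, t) < d" using that T by (simp add: dist_Pair_Pair)
    moreover have "(s, t) \<in> {-1..1} \<times> {0..2 * pi}" using that T by auto
    ultimately show False
      using close[of "(0, t)" "(s, t)"] that by (auto simp: dist_real_def)
  qed

  \<comment> \<open>The multiplier taking \<open>u\<close> to \<open>x\<^sup>2 + y\<^sup>2\<close>
    times its Laplacian; the bound \<open>N_nz\<close> makes it continuous, hence bounded, on the
    rectangle.\<close>
  define V where "V = (\<lambda>z. (\<lambda>x y. (x\<^sup>2 + y\<^sup>2) * (x * Lx x y + y * Ly x y)) (fst (polar z)) (snd (polar z)) / N z)"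
  have "continuous_on ({-T..T} \<times> {0..2 * pi}) V"
    unfolding V_def
  proof (intro continuous_on_divide cont_polar N_cont)
    show "continuous_on UNIV (\<lambda>z. ((fst z)\<^sup>2 + (snd z)\<^sup>2) *
        (fst z * Lx (fst z) (snd z) + snd z * Ly (fst z) (snd z)))"
      unfolding Lx_def Ly_def
      by (intro continuous_intros has_C1_partialsD(3)[OF pxx] has_C1_partialsD(4)[OF pxx]
          has_C1_partialsD(4)[OF pxy] has_C1_partialsD(4)[OF pyy])
    show "\<forall>z\<in>{-T..T} \<times> {0..2 * pi}. N z \<noteq> 0" using N_nz by auto
  qed
  then have "bounded (V ` ({-T..T} \<times> {0..2 * pi}))"
    by (intro compact_imp_bounded compact_continuous_image compact_Times compact_Icc)
  then obtain M where M: "\<And>z. z \<in> {-T..T} \<times> {0..2 * pi} \<Longrightarrow> \<bar>V z\<bar> \<le> M"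
    unfolding bounded_iff by auto

  have bound: "\<bar>(x\<^sup>2 + y\<^sup>2) * (uxx x y + uyy x y)\<bar> \<le> M * \<bar>u x y\<bar>"
    if s: "\<bar>s\<bar> \<le> T" and t: "t \<in> {0..2 * pi}" and x: "x = r * exp s * cos t" and y: "y = r * exp s * sin t"
    for s t x y
  proof -
    have pol: "polar (s, t) = (x, y)" by (simp add: polar_def x y)
    have nz: "W x y \<noteq> 0" using N_nz[OF s t] by (simp add: N_def pol)
    \<comment> \<open>The Laplacian of \<open>u\<close> is \<open>x * Ly - y * Lx\<close>, and the
      Euler equation reads \<open>px * Ly = py * Lx\<close>; expanding both sides gives the
      identity.\<close>
    have "W x y * (uxx x y + uyy x y) = u x y * (x * Lx x y + y * Ly x y)"
      using euler[of x y] unfolding W_def uxx_def uyy_def u_def Lx_def Ly_def by algebra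
    then have "uxx x y + uyy x y = u x y * (x * Lx x y + y * Ly x y) / W x y"
      using nz by (simp add: nonzero_eq_divide_eq mult.commute)
    then have eq: "(x\<^sup>2 + y\<^sup>2) * (uxx x y + uyy x y) = V (s, t) * u x y"
      by (simp add: V_def N_def pol)
    have "\<bar>V (s, t)\<bar> \<le> M" using s t by (intro M) auto
    then have "\<bar>V (s, t)\<bar> * \<bar>u x y\<bar> \<le> M * \<bar>u x y\<bar>" by (rule mult_right_mono) simp
    then show ?thesis by (simp only: eq abs_mult)
  qed
  \<comment> \<open>The strip result covers only nonnegative parameters, so the inner side is
    reached with \<open>\<sigma> = -1\<close> at \<open>- s\<close>.\<close>
  have vanish: "u (r * exp s * cos t) (r * exp s * sin t) = 0" if "\<bar>s\<bar> \<le> T / 2" "t \<in> {0..2 * pi}" for s t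
  proof (cases "0 \<le> s")
    case True
    have "u (r * exp (1 * s) * cos t) (r * exp (1 * s) * sin t) = 0"
      by (rule unique_continuation_circle[OF T(1,2) _ u ux uy bound u0 us0]) (use that True in auto)
    then show ?thesis by simp
  next
    case False
    have "u (r * exp (- 1 * - s) * cos t) (r * exp (- 1 * - s) * sin t) = 0"
      by (rule unique_continuation_circle[OF T(1,2) _ u ux uy bound u0 us0]) (use that False in auto)
    then show ?thesis by simp
  qed
  \<comment> \<open>Chosen so that \<open>\<bar>\<rho> - r\<bar> < e\<close> forces
    \<open>\<bar>ln (\<rho> / r)\<bar> \<le> T / 2\<close>.\<close>
  define e where "e = min (r - r * exp (- (T / 2))) (r * exp (T / 2) - r)"
  have "0 < e" using r T by (simp add: e_def)
  moreover have "\<rho> \<in> I" if "\<bar>\<rho> - r\<bar> < e" for \<rho>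
  proof -
    have \<rho>: "r * exp (- (T / 2)) < \<rho>" "\<rho> < r * exp (T / 2)" using that by (auto simp: e_def)
    have pos: "0 < \<rho>" by (rule le_less_trans[OF _ \<rho>(1)]) (use r in simp)
    define s where "s = ln (\<rho> / r)"
    have s: "r * exp s = \<rho>" using r pos by (simp add: s_def)
    have "r * exp (- (T / 2)) < r * exp s" "r * exp s < r * exp (T / 2)" using \<rho> s by auto
    then have "\<bar>s\<bar> \<le> T / 2" using r by simp
    have "u (\<rho> * cos t) (\<rho> * sin t) = 0" for t
    proof -
      obtain t' where "0 \<le> t'" "t' < 2 * pi" "cos t = cos t'" "sin t = sin t'"
        using sincos_total_2pi[OF sin_cos_squared_add2] by metis
      then show ?thesis using vanish[OF \<open>\<bar>s\<bar> \<le> T / 2\<close>, of t'] s by simp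
    qed
    then show ?thesis using pos by (simp add: I_iff)
  qed
  ultimately show ?thesis by blast
qed

section \<open>Return to the plane: mixed partials and polar form of the radial set\<close>

lemma Ck_partial_commute:
  fixes f :: "real^2 \<Rightarrow> real"
  assumes "Ck (Suc (Suc k)) f"
  shows "partial 1 (partial 2 f) = partial 2 (partial 1 f)"
proof -
  have "Ck (Suc k) (partial i f)" for i using assms by simp
  then have "cart (partial 2 (partial 1 f)) = cart (partial 1 (partial 2 f))"
    using mixed_partials_eq[OF Ck_Suc_has_C1_partials[OF assms] Ck_Suc_has_C1_partials Ck_Suc_has_C1_partials]
    by blast
  then have "partial 1 (partial 2 f) (vector [x, y]) = partial 2 (partial 1 f) (vector [x, y])" for x y
    unfolding cart_def by metis
  then show ?thesis by (simp add: fun_eq_iff forall_vector_2)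
qed

text \<open>Additivity of \<open>deriv\<close> requires both summands to be differentiable, which
  three orders of smoothness guarantee.\<close>

lemma partial_laplacian:
  assumes "Ck 3 f"
  shows "partial i (laplacian f) x = partial i (partial 1 (partial 1 f)) x + partial i (partial 2 (partial 2 f)) x"
proof -
  have "Ck (Suc 0) (partial j (partial j f))" for j
    using assms by (simp add: numeral_3_eq_3)
  then have d: "((\<lambda>t. partial j (partial j f) (x + t *\<^sub>R axis i 1)) has_real_derivative
      partial i (partial j (partial j f)) x) (at 0)" for j
    by (auto simp: partial_def[of i "partial j (partial j f)"] DERIV_deriv_iff_real_differentiable)
  have "((\<lambda>t. laplacian f (x + t *\<^sub>R axis i 1)) has_real_derivative
      partial i (partial 1 (partial 1 f)) x + partial i (partial 2 (partial 2 f)) x) (at 0)"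
    unfolding laplacian_def by (intro DERIV_add d)
  then show ?thesis
    unfolding partial_def[of i "laplacian f"] by (rule DERIV_imp_deriv)
qed

lemma norm_polar: "0 \<le> \<rho> \<Longrightarrow> norm (vector [\<rho> * cos t, \<rho> * sin t] :: real^2) = \<rho>"
  by (simp add: norm_vec_def L2_set_def sum_2 power_mult_distrib flip: distrib_left)

lemma norm_eq_imp_polar:
  fixes x :: "real^2"
  assumes "norm x = \<rho>"
  obtains t where "x = vector [\<rho> * cos t, \<rho> * sin t]"
proof (cases "\<rho> = 0")
  case True
  then show ?thesis using assms that[of 0] by (simp add: vec_eq_iff forall_2)
next
  case False
  then have pos: "0 < \<rho>" using assms by (metis norm_ge_zero less_eq_real_def)
  have sq: "\<rho>\<^sup>2 = (x $ 1)\<^sup>2 + (x $ 2)\<^sup>2"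
    using assms by (auto simp: norm_vec_def L2_set_def sum_2)
  then have "(x $ 1 / \<rho>)\<^sup>2 + (x $ 2 / \<rho>)\<^sup>2 = 1"
    using pos by (simp add: power_divide flip: add_divide_distrib sq)
  then obtain t where "x $ 1 / \<rho> = cos t" "x $ 2 / \<rho> = sin t"
    using sincos_total_2pi by metis
  then show ?thesis using pos by (intro that[of t]) (auto simp: vec_eq_iff forall_2 field_simps)
qed

text \<open>Polar angles reach every point of a circle, including the degenerate one. This gives the
  set the shape of \<open>I\<close> in \<open>circles_constant_near\<close>.\<close>

lemma radial_set_polar:
  "radial_set \<phi> = {\<rho>. 0 \<le> \<rho> \<and> (\<forall>t t'. cart \<phi> (\<rho> * cos t) (\<rho> * sin t) = cart \<phi> (\<rho> * cos t') (\<rho> * sin t'))}"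
proof -
  have "(\<forall>x y. norm x = \<rho> \<longrightarrow> norm y = \<rho> \<longrightarrow> \<phi> x = \<phi> y) \<longleftrightarrow>
      (\<forall>t t'. cart \<phi> (\<rho> * cos t) (\<rho> * sin t) = cart \<phi> (\<rho> * cos t') (\<rho> * sin t'))" if "0 \<le> \<rho>" for \<rho>
  proof
    assume c: "\<forall>x y. norm x = \<rho> \<longrightarrow> norm y = \<rho> \<longrightarrow> \<phi> x = \<phi> y"
    show "\<forall>t t'. cart \<phi> (\<rho> * cos t) (\<rho> * sin t) = cart \<phi> (\<rho> * cos t') (\<rho> * sin t')"
      unfolding cart_def using c norm_polar[OF that] by blast
  next
    assume c: "\<forall>t t'. cart \<phi> (\<rho> * cos t) (\<rho> * sin t) = cart \<phi> (\<rho> * cos t') (\<rho> * sin t')"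
    show "\<forall>x y. norm x = \<rho> \<longrightarrow> norm y = \<rho> \<longrightarrow> \<phi> x = \<phi> y"
    proof (intro allI impI)
      fix x y :: "real^2"
      assume "norm x = \<rho>" "norm y = \<rho>"
      then obtain t t' where "x = vector [\<rho> * cos t, \<rho> * sin t]" "y = vector [\<rho> * cos t', \<rho> * sin t']"
        by (elim norm_eq_imp_polar)
      then show "\<phi> x = \<phi> y" using c unfolding cart_def by blast
    qed
  qed
  then show ?thesis unfolding radial_set_def by blast
qed

section \<open>Contradiction with the boundary hypothesis\<close>

theorem theorem1p2:
  fixes \<Omega> :: real and \<phi> :: "real^2 \<Rightarrow> real" and r :: real
  assumes C3: "Ck 3 \<phi>"
    and euler: "\<forall>x. perp_grad_dot \<phi> (laplacian \<phi>) x = 0"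
    and outside: "\<exists>R. \<forall>x. norm x > R \<longrightarrow> \<phi> x = - (\<Omega> / 2) * (norm x)\<^sup>2"
    and bdry: "r \<in> (top_of_set {0..}) frontier_of (radial_set \<phi>)"
    and nonzero: "r \<noteq> 0"
    and not_isolated: "r islimpt (radial_set \<phi>)"
  shows "\<forall>x. norm x = r \<longrightarrow> partial 1 \<phi> x = 0 \<and> partial 2 \<phi> x = 0"
proof (rule ccontr)
  let ?I = "radial_set \<phi>"
  assume "\<not> ?thesis"
  then obtain x where x: "norm x = r" "partial 1 \<phi> x \<noteq> 0 \<or> partial 2 \<phi> x \<noteq> 0" by blast
  have r: "0 < r" using x nonzero by (metis norm_ge_zero less_eq_real_def)
  obtain t0 where t0: "x = vector [r * cos t0, r * sin t0]" using norm_eq_imp_polar[OF x(1)] .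
  let ?p = "partial 1 \<phi>" and ?q = "partial 2 \<phi>"
  have C: "Ck (Suc (Suc (Suc 0))) \<phi>" "Ck (Suc (Suc 0)) (partial i \<phi>)" "Ck (Suc 0) (partial j (partial i \<phi>))" for i j
    using C3 by (simp_all add: numeral_3_eq_3)
  \<comment> \<open>The three identities bring mixed partials to one normal form, with
    \<open>partial 2\<close> outermost, so that the shared names in
    \<open>circles_constant_near\<close> can be instantiated.\<close>
  have c1: "partial 1 ?q = partial 2 ?p" by (rule Ck_partial_commute[OF C(1)])
  have c2: "partial 1 (partial 2 ?p) = partial 2 (partial 1 ?p)" by (rule Ck_partial_commute[OF C(2)])
  have c3: "partial 1 (partial 2 ?q) = partial 2 (partial 2 ?p)"
    using Ck_partial_commute[OF C(2)[of 2]] by (simp add: c1)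
  have euler': "cart ?p x y * (cart (partial 2 (partial 1 ?p)) x y + cart (partial 2 (partial 2 ?q)) x y) =
      cart ?q x y * (cart (partial 1 (partial 1 ?p)) x y + cart (partial 2 (partial 2 ?p)) x y)" for x y
    using euler[rule_format, of "vector [x, y]"]
    by (simp add: perp_grad_dot_def partial_laplacian[OF C3] c3 cart_def)
  have "\<exists>e>0. \<forall>\<rho>. \<bar>\<rho> - r\<bar> < e \<longrightarrow> 0 \<le> \<rho> \<longrightarrow> \<rho> \<in> ?I"
    unfolding radial_set_polar
  proof (rule circles_constant_near)
    show "has_C1_partials (cart \<phi>) (cart ?p) (cart ?q)"
      by (rule Ck_Suc_has_C1_partials[OF C(1)])
    show "has_C1_partials (cart ?p) (cart (partial 1 ?p)) (cart (partial 2 ?p))"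
      by (rule Ck_Suc_has_C1_partials[OF C(2)])
    show "has_C1_partials (cart ?q) (cart (partial 2 ?p)) (cart (partial 2 ?q))"
      using Ck_Suc_has_C1_partials[OF C(2)[of 2]] unfolding c1 .
    show "has_C1_partials (cart (partial 1 ?p)) (cart (partial 1 (partial 1 ?p))) (cart (partial 2 (partial 1 ?p)))"
      by (rule Ck_Suc_has_C1_partials[OF C(3)])
    show "has_C1_partials (cart (partial 2 ?p)) (cart (partial 2 (partial 1 ?p))) (cart (partial 2 (partial 2 ?p)))"
      using Ck_Suc_has_C1_partials[OF C(3)[of 2 1]] unfolding c2 .
    show "has_C1_partials (cart (partial 2 ?q)) (cart (partial 2 (partial 2 ?p))) (cart (partial 2 (partial 2 ?q)))"
      using Ck_Suc_has_C1_partials[OF C(3)[of 2 2]] unfolding c3 .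
    show "cart ?p (r * cos t0) (r * sin t0) \<noteq> 0 \<or> cart ?q (r * cos t0) (r * sin t0) \<noteq> 0"
      using x(2) by (simp add: cart_def t0)
  qed (use euler' r not_isolated in \<open>simp_all only: radial_set_polar\<close>)
  then obtain e where e: "0 < e" "\<And>\<rho>. \<bar>\<rho> - r\<bar> < e \<Longrightarrow> 0 \<le> \<rho> \<Longrightarrow> \<rho> \<in> ?I" by blast
  \<comment> \<open>The interior is relative to the half line, so the ball is cut with
    \<open>{0..}\<close>; a relative interior point cannot lie in the frontier.\<close>
  have "r \<in> (top_of_set {0..}) interior_of ?I"
    unfolding interior_of_def
  proof (intro CollectI exI conjI)
    show "openin (top_of_set {0..}) ({0..} \<inter> ball r e)" by (simp add: openin_open_Int)
    show "r \<in> {0..} \<inter> ball r e" using r e by simp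
    show "{0..} \<inter> ball r e \<subseteq> ?I" using e(2) by (auto simp: dist_real_def abs_minus_commute)
  qed
  with bdry show False by (simp add: frontier_of_def)
qed

end
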